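(* Let $s\ge 2$, $k\ge1$, $0\le t\le k$, $\lambda\ge1$ be integers and let $m=\sum_{i=t+1}^k\binom{k}{i}(s-1)^i$. Then the polytope $\mathrm{OAP}(k,s,t,\lambda)\subseteq\mathbb R^m$ is full dimensional.
   Context: Let $\{a_c\}$ be defined by $a_0=\lambda$, $a_c=\lambda-\sum_{e=0}^{c-1}a_e\binom{k-t}{c-e}(s-1)^{c-e}$ for $c\ge1$. Write $[s]=\{1,\dots,s\}$, $\mathbf 1=(1,\dots,1)\in[s]^k$, and $d(\mathbf u,\mathbf v)$ for the Hamming distance (number of differing coordinates) on $[s]^k$. For $\mathbf x\in[s]^k$ let $I_{\mathbf x}=\{i:x_i\ne1\}$, $J_{\mathbf x}=\{\mathbf y\in[s]^k: y_i=x_i\ \forall i\in I_{\mathbf x}\}$. The set $\mathrm{OAP}(k,s,t,\lambda)$ (the LP relaxation orthogonal array polytope) is the set of real vectors $(N_{\mathbf y})$, indexed by the $m$ points $\mathbf y\in[s]^k$ with $d(\mathbf 1,\mathbf y)\ge t+1$, satisfying $N_{\mathbf y}\ge0$ for all such $\mathbf y$ and, for every $\mathbf x\in[s]^k$ with $0\le d(\mathbf 1,\mathbf x)\le t$, $a_{t-d(\mathbf 1,\mathbf x)}+(-1)^{t-d(\mathbf 1,\mathbf x)+1}\sum_{\mathbf y\in J_{\mathbf x},\,d(\mathbf 1,\mathbf y)>t}\binom{d(\mathbf 1,\mathbf y)-d(\mathbf 1,\mathbf x)-1}{t-d(\mathbf 1,\mathbf x)}N_{\mathbf y}\ge0$.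 *)

theory Defs
  imports "HOL-Analysis.Analysis"
begin

text \<open>
  Points of \<open>[s]\<^sup>k\<close> are rendered as vectors of type \<open>'s ^ 'k\<close> with \<open>CARD('s) = s\<close> and
  \<open>CARD('k) = k\<close>; the symbol \<open>1 \<in> [s]\<close> is an arbitrary distinguished element \<open>o1 :: 's\<close>.
\<close>

definition hamming :: "'s ^ 'k::finite \<Rightarrow> 's ^ 'k \<Rightarrow> nat" where
  "hamming u v = card {i. u $ i \<noteq> v $ i}"

definition all_one :: "'s \<Rightarrow> 's ^ 'k::finite" where
  "all_one o1 = (\<chi> i. o1)"

definition I_set :: "'s \<Rightarrow> 's ^ 'k::finite \<Rightarrow> 'k set" where
  "I_set o1 x = {i. x $ i \<noteq> o1}"

definition J_set :: "'s \<Rightarrow> 's ^ 'k::finite \<Rightarrow> ('s ^ 'k) set" where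
  "J_set o1 x = {y. \<forall>i \<in> I_set o1 x. y $ i = x $ i}"

function oa_coeff :: "nat \<Rightarrow> nat \<Rightarrow> nat \<Rightarrow> nat \<Rightarrow> nat \<Rightarrow> real" where
  "oa_coeff k s t l c =
     (if c = 0 then real l
      else real l - (\<Sum>e = 0..<c.
             oa_coeff k s t l e * real ((k - t) choose (c - e)) * (real s - 1) ^ (c - e)))"
  by pat_completeness auto
termination
  by (relation "Wellfounded.measure (\<lambda>(k, s, t, l, c). c)") auto

declare oa_coeff.simps [simp del]

text \<open>
  The space \<open>\<real>\<^sup>m\<close>, whose coordinates are the points at distance greater than \<open>t\<close> from the
  all-one point, is realised as the coordinate subspace of \<open>real ^ ('s ^ 'k)\<close> in which all
  other coordinates vanish. This also covers \<open>t = k\<close>, where \<open>m = 0\<close>.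
\<close>

definition OAP :: "'s::finite \<Rightarrow> nat \<Rightarrow> nat \<Rightarrow> (real ^ ('s ^ 'k::finite)) set" where
  "OAP o1 t l =
     {N. (\<forall>y. hamming (all_one o1) y \<le> t \<longrightarrow> N $ y = 0) \<and>
         (\<forall>y. hamming (all_one o1) y \<ge> t + 1 \<longrightarrow> N $ y \<ge> 0) \<and>
         (\<forall>x. hamming (all_one o1) x \<le> t \<longrightarrow>
            oa_coeff CARD('k) CARD('s) t l (t - hamming (all_one o1) x)
            + (-1) ^ (t - hamming (all_one o1) x + 1)
              * (\<Sum>y \<in> {y \<in> J_set o1 x. hamming (all_one o1) y > t}.
                   real ((hamming (all_one o1) y - hamming (all_one o1) x - 1)
                           choose (t - hamming (all_one o1) x)) * N $ y)
            \<ge> 0)}"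

end

theory Submission
  imports Defs
begin

text \<open>
  The constant vector with entries \<open>\<lambda> s\<^sup>t / s\<^sup>k\<close> lies in the interior: it is the fractional
  orthogonal array that contains every run equally often, and the left-hand side of the
  inequality for \<open>x\<close> recovers the multiplicity of the run \<open>x\<close>, which is again \<open>\<lambda> s\<^sup>t / s\<^sup>k > 0\<close>.
  The last identity follows from generating functions: the coefficients \<open>a\<^sub>c\<close> have the
  generating function \<open>\<lambda> / ((1 - X) (1 + q X)\<^sup>r)\<close> with \<open>q = s - 1\<close> and \<open>r = k - t\<close>.
\<close>

section \<open>Alternating sums and the generating function of the coefficients\<close>

text \<open>Up to sign, the sum in the inequality for \<open>x\<close> at the constant vector 1:
  \<open>q\<close> is \<open>s - 1\<close>, \<open>r\<close> is \<open>k - t\<close>,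
  \<open>j\<close> is \<open>t\<close> minus the distance of \<open>x\<close>, and \<open>v\<close>
  stands for the points \<open>y\<close> at distance \<open>t + 1 + v\<close>.\<close>

definition alt_sum :: "real \<Rightarrow> nat \<Rightarrow> nat \<Rightarrow> real" where
  "alt_sum q r j = (\<Sum>v<r. real ((r + j) choose (j + 1 + v)) * real ((j + v) choose j) * q ^ (j + 1 + v))"

lemma alt_sum_Suc_0: "1 + alt_sum q (Suc r) 0 = (1 + q) * (1 + alt_sum q r 0)"
proof -
  have "1 + alt_sum q r 0 = (1 + q) ^ r" for r
  proof -
    have "(1 + q) ^ r = (q + 1) ^ r" by (simp add: add.commute)
    also have "\<dots> = (\<Sum>v\<le>r. real (r choose v) * q ^ v)"
      by (simp add: binomial_ring)
    also have "\<dots> = (\<Sum>v<Suc r. real (r choose v) * q ^ v)"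
      by (simp add: lessThan_Suc_atMost)
    also have "\<dots> = 1 + alt_sum q r 0"
      unfolding sum.lessThan_Suc_shift by (simp add: alt_sum_def)
    finally show ?thesis by simp
  qed
  then show ?thesis by simp
qed

text \<open>Pascal's rule, applied to the first binomial factor and then, in one of the two
  resulting sums, to the second.\<close>

lemma alt_sum_Suc_Suc:
  "alt_sum q (Suc r) (Suc j) = q * alt_sum q (Suc r) j + (1 + q) * alt_sum q r (Suc j)"
proof -
  let ?n = "r + Suc j"
  have "alt_sum q (Suc r) (Suc j)
      = (\<Sum>v<Suc r. real (?n choose (Suc j + 1 + v)) * real ((Suc j + v) choose Suc j) * q ^ (Suc j + 1 + v))
      + (\<Sum>v<Suc r. real (?n choose (Suc j + v)) * real ((Suc j + v) choose Suc j) * q ^ (Suc j + 1 + v))"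
    unfolding alt_sum_def sum.distrib [symmetric]
    by (rule sum.cong) (simp_all add: distrib_right)
  \<comment> \<open>The term \<open>v = r\<close> vanishes, its lower index being
    \<open>?n + 1\<close>.\<close>
  also have "(\<Sum>v<Suc r. real (?n choose (Suc j + 1 + v)) * real ((Suc j + v) choose Suc j) * q ^ (Suc j + 1 + v))
      = alt_sum q r (Suc j)"
    by (simp add: alt_sum_def binomial_eq_0 del: binomial_Suc_Suc)
  also have "(\<Sum>v<Suc r. real (?n choose (Suc j + v)) * real ((Suc j + v) choose Suc j) * q ^ (Suc j + 1 + v))
      = (\<Sum>v<Suc r. real (?n choose (Suc j + v)) * real ((j + v) choose j) * q ^ (Suc j + 1 + v))
      + (\<Sum>v<Suc r. real (?n choose (Suc j + v)) * real ((j + v) choose Suc j) * q ^ (Suc j + 1 + v))"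
    by (simp only: sum.distrib [symmetric]) (rule sum.cong, auto simp: algebra_simps)
  also have "(\<Sum>v<Suc r. real (?n choose (Suc j + v)) * real ((j + v) choose j) * q ^ (Suc j + 1 + v))
      = q * alt_sum q (Suc r) j"
    unfolding alt_sum_def sum_distrib_left by (rule sum.cong) (auto simp: algebra_simps)
  \<comment> \<open>The term \<open>v = 0\<close> vanishes because \<open>j choose Suc j\<close> is
    0; shifting the remaining ones by one gives the extra factor \<open>q\<close>.\<close>
  also have "(\<Sum>v<Suc r. real (?n choose (Suc j + v)) * real ((j + v) choose Suc j) * q ^ (Suc j + 1 + v))
      = q * alt_sum q r (Suc j)"
    unfolding alt_sum_def sum_distrib_left sum.lessThan_Suc_shift
    by (auto intro!: sum.cong simp: algebra_simps simp del: binomial_Suc_Suc)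
  finally show ?thesis by (simp add: algebra_simps)
qed

lemma fps_one_plus_linear_power_nth:
  "fps_nth ((1 + fps_const (q :: real) * fps_X) ^ r) n = real (r choose n) * q ^ n"
proof -
  have "(1 + fps_const q * fps_X) ^ r = (fps_const q * fps_X + 1) ^ r" by (simp add: add.commute)
  also have "\<dots> = (\<Sum>i\<le>r. of_nat (r choose i) * (fps_const q * fps_X) ^ i)"
    by (simp add: binomial_ring)
  also have "\<dots> = (\<Sum>i\<le>r. fps_const (real (r choose i) * q ^ i) * fps_X ^ i)"
    by (simp only: power_mult_distrib fps_const_power fps_const_mult fps_of_nat [symmetric] mult.assoc [symmetric])
  finally have "fps_nth ((1 + fps_const q * fps_X) ^ r) n =
     (\<Sum>i\<le>r. real (r choose i) * q ^ i * (if n = i then 1 else 0))"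
    by (simp add: fps_sum_nth fps_X_power_nth)
  then show ?thesis
    by (auto simp: if_distrib binomial_eq_0 cong: if_cong split: if_splits)
qed

lemma alt_sum_gen_fun:
  "(1 + fps_const q * fps_X) ^ r * Abs_fps (\<lambda>j. 1 + (-1) ^ j * alt_sum q r j)
    = fps_const ((1 + q) ^ r) * Abs_fps (\<lambda>_. 1)"
proof (induction r)
  case 0
  then show ?case by (simp add: alt_sum_def)
next
  case (Suc r)
  let ?G = "\<lambda>r. Abs_fps (\<lambda>j. 1 + (-1) ^ j * alt_sum q r j)"
  have step: "(1 + fps_const q * fps_X) * ?G (Suc r) = fps_const (1 + q) * ?G r"
  proof (rule fps_ext)
    fix n
    show "fps_nth ((1 + fps_const q * fps_X) * ?G (Suc r)) n = fps_nth (fps_const (1 + q) * ?G r) n"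
    proof (cases n)
      case 0
      then show ?thesis
        using alt_sum_Suc_0 [of q r] by (simp add: distrib_right mult.assoc)
    next
      case (Suc j)
      then show ?thesis
        using alt_sum_Suc_Suc [of q r j] by (simp add: algebra_simps)
    qed
  qed
  have "(1 + fps_const q * fps_X) ^ Suc r * ?G (Suc r)
      = (1 + fps_const q * fps_X) ^ r * (fps_const (1 + q) * ?G r)"
    by (simp only: power_Suc2 mult.assoc step)
  also have "\<dots> = fps_const (1 + q) * ((1 + fps_const q * fps_X) ^ r * ?G r)"
    by (simp only: mult.left_commute)
  also have "\<dots> = fps_const ((1 + q) ^ Suc r) * Abs_fps (\<lambda>_. 1)"
    by (simp only: Suc.IH mult.assoc [symmetric] fps_const_mult power_Suc)
  finally show ?case .
qed

text \<open>With its sum moved to the left, the recursion says that convolving the coefficients with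
  those of the binomial power gives the constant sequence \<open>l\<close>.\<close>

lemma oa_coeff_gen_fun:
  "(1 + fps_const (real s - 1) * fps_X) ^ (k - t) * Abs_fps (oa_coeff k s t l)
    = fps_const (real l) * Abs_fps (\<lambda>_. 1)"
proof (rule fps_ext)
  fix c
  have "fps_nth ((1 + fps_const (real s - 1) * fps_X) ^ (k - t) * Abs_fps (oa_coeff k s t l)) c
     = (\<Sum>e = 0..c. oa_coeff k s t l e * (real ((k - t) choose (c - e)) * (real s - 1) ^ (c - e)))"
    by (subst mult.commute) (simp add: fps_mult_nth fps_one_plus_linear_power_nth)
  also have "\<dots> = oa_coeff k s t l c +
      (\<Sum>e = 0..<c. oa_coeff k s t l e * real ((k - t) choose (c - e)) * (real s - 1) ^ (c - e))"
    by (cases c) (simp_all add: atLeastLessThanSuc_atLeastAtMost mult.assoc)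
  \<comment> \<open>Unfolding only the leading coefficient makes the two sums cancel; for
    \<open>c = 0\<close> the sum is empty.\<close>
  also have "\<dots> = real l"
    by (subst (1) oa_coeff.simps) simp
  finally show "fps_nth ((1 + fps_const (real s - 1) * fps_X) ^ (k - t) * Abs_fps (oa_coeff k s t l)) c
     = fps_nth (fps_const (real l) * Abs_fps (\<lambda>_. 1)) c" by simp
qed

text \<open>Both series become multiples of the all-ones series after multiplication by
  \<open>?P\<close>, which has constant coefficient 1 and hence cancels.\<close>

lemma oa_coeff_closed_form:
  assumes "s \<ge> 1"
  shows "oa_coeff k s t l j
    = real l / real s ^ (k - t) * (1 + (-1) ^ j * alt_sum (real s - 1) (k - t) j)"
proof -
  let ?q = "real s - 1" and ?r = "k - t"
  let ?P = "(1 + fps_const ?q * fps_X) ^ ?r"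
  let ?G = "Abs_fps (\<lambda>j. 1 + (-1) ^ j * alt_sum ?q ?r j)"
  have "fps_nth ?P 0 \<noteq> 0" unfolding fps_one_plus_linear_power_nth by simp
  then have nz: "?P \<noteq> 0" by (metis fps_zero_nth)
  have "?P * (fps_const (real s ^ ?r) * Abs_fps (oa_coeff k s t l))
      = fps_const (real s ^ ?r) * (?P * Abs_fps (oa_coeff k s t l))"
    by (simp only: mult.left_commute)
  also have "\<dots> = fps_const (real l) * (?P * ?G)"
    unfolding oa_coeff_gen_fun alt_sum_gen_fun by (simp add: mult.left_commute)
  also have "\<dots> = ?P * (fps_const (real l) * ?G)"
    by (simp only: mult.left_commute)
  finally have "fps_const (real s ^ ?r) * Abs_fps (oa_coeff k s t l) = fps_const (real l) * ?G"
    using nz by simp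
  then have "fps_nth (fps_const (real s ^ ?r) * Abs_fps (oa_coeff k s t l)) j
      = fps_nth (fps_const (real l) * ?G) j" by simp
  then show ?thesis
    using assms by (simp add: field_simps)
qed

section \<open>Counting points by support and distance\<close>

lemma card_vec_box: "card {y :: 'a::finite ^ 'n::finite. \<forall>i. y $ i \<in> B i} = (\<Prod>i\<in>UNIV. card (B i))"
proof -
  have "bij_betw vec_nth {y :: 'a ^ 'n. \<forall>i. y $ i \<in> B i} (PiE UNIV B)"
    by (rule bij_betw_byWitness [where f' = vec_lambda]) (auto simp: PiE_def)
  then show ?thesis
    by (simp add: bij_betw_same_card card_PiE)
qed

lemma hamming_all_one: "hamming (all_one o1) y = card (I_set o1 y)"
  by (simp add: hamming_def all_one_def I_set_def eq_commute)

text \<open>These points form a box: the entries on the support of \<open>x\<close> are forced,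
  those on the rest of \<open>K\<close> avoid \<open>o1\<close>, and all others equal
  \<open>o1\<close>.\<close>

lemma card_J_set_support:
  fixes x :: "'s::finite ^ 'k::finite"
  assumes "I_set o1 x \<subseteq> K"
  shows "card {y \<in> J_set o1 x. I_set o1 y = K} = (CARD('s) - 1) ^ (card K - card (I_set o1 x))"
proof -
  let ?I = "I_set o1 x"
  define B where "B i = (if i \<in> ?I then {x $ i} else if i \<in> K then - {o1} else {o1})" for i
  have "{y \<in> J_set o1 x. I_set o1 y = K} = {y. \<forall>i. y $ i \<in> B i}"
    using assms by (auto simp: J_set_def I_set_def B_def split: if_splits)
  then have "card {y \<in> J_set o1 x. I_set o1 y = K} = (\<Prod>i\<in>UNIV. card (B i))"
    by (simp add: card_vec_box)
  also have "\<dots> = (\<Prod>i\<in>K - ?I. CARD('s) - 1)"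
    by (rule prod.mono_neutral_cong_right) (auto simp: B_def Compl_eq_Diff_UNIV card_Diff_subset)
  also have "\<dots> = (CARD('s) - 1) ^ (card K - card ?I)"
    using assms by (simp add: card_Diff_subset)
  finally show ?thesis .
qed

lemma card_J_set_hamming:
  fixes x :: "'s::finite ^ 'k::finite"
  assumes "card (I_set o1 x) \<le> h"
  shows "card {y \<in> J_set o1 x. hamming (all_one o1) y = h}
    = (CARD('k) - card (I_set o1 x) choose (h - card (I_set o1 x)))
      * (CARD('s) - 1) ^ (h - card (I_set o1 x))"
proof -
  let ?I = "I_set o1 x"
  let ?S = "{K. ?I \<subseteq> K \<and> card K = h}"
  \<comment> \<open>A support containing \<open>?I\<close> amounts to a choice of
    \<open>h - card ?I\<close> further coordinates.\<close>
  have "bij_betw (\<lambda>K. K - ?I) ?S {L. L \<subseteq> - ?I \<and> card L = h - card ?I}"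
  proof (rule bij_betw_byWitness [where f' = "\<lambda>L. L \<union> ?I"])
    show "(\<lambda>L. L \<union> ?I) ` {L. L \<subseteq> - ?I \<and> card L = h - card ?I} \<subseteq> ?S"
    proof clarify
      fix L assume L: "L \<subseteq> - ?I" "card L = h - card ?I"
      then have "card (L \<union> ?I) = card L + card ?I"
        by (intro card_Un_disjoint) auto
      with L assms show "?I \<subseteq> L \<union> ?I \<and> card (L \<union> ?I) = h" by auto
    qed
  qed (auto simp: card_Diff_subset)
  then have card_S: "card ?S = (CARD('k) - card ?I choose (h - card ?I))"
    by (simp add: bij_betw_same_card n_subsets Compl_eq_Diff_UNIV card_Diff_subset)
  have "?I \<subseteq> I_set o1 y" if "y \<in> J_set o1 x" for y
    using that unfolding J_set_def I_set_def by force
  then have "{y \<in> J_set o1 x. hamming (all_one o1) y = h}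
      = (\<Union>K\<in>?S. {y \<in> J_set o1 x. I_set o1 y = K})"
    by (auto simp: hamming_all_one)
  then have "card {y \<in> J_set o1 x. hamming (all_one o1) y = h}
      = (\<Sum>K\<in>?S. card {y \<in> J_set o1 x. I_set o1 y = K})"
    by (simp only:) (rule card_UN_disjoint, auto)
  also have "\<dots> = (\<Sum>K\<in>?S. (CARD('s) - 1) ^ (h - card ?I))"
    by (rule sum.cong) (auto simp: card_J_set_support)
  finally show ?thesis by (simp add: card_S)
qed

text \<open>The semiring is left general to serve both the weighted real sums in the inequalities
  and the natural number count of the coordinates.\<close>

lemma sum_J_set_hamming:
  fixes x :: "'s::finite ^ 'k::finite" and f :: "nat \<Rightarrow> 'b::comm_semiring_1"
  assumes "card (I_set o1 x) \<le> t"
  shows "(\<Sum>y \<in> {y \<in> J_set o1 x. hamming (all_one o1) y > t}. f (hamming (all_one o1) y))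
    = (\<Sum>h = t + 1..CARD('k). of_nat ((CARD('k) - card (I_set o1 x) choose (h - card (I_set o1 x)))
      * (CARD('s) - 1) ^ (h - card (I_set o1 x))) * f h)"
proof -
  let ?H = "hamming (all_one o1) :: 's ^ 'k \<Rightarrow> nat"
  let ?A = "{y \<in> J_set o1 x. ?H y > t}"
  have "(\<Sum>y \<in> ?A. f (?H y)) = (\<Sum>h = t + 1..CARD('k). \<Sum>y \<in> {y \<in> ?A. ?H y = h}. f (?H y))"
    by (rule sum.group [symmetric]) (auto simp: hamming_def intro!: card_mono)
  also have "\<dots> = (\<Sum>h = t + 1..CARD('k). of_nat (card {y \<in> J_set o1 x. ?H y = h}) * f h)"
  proof (rule sum.cong)
    fix h assume "h \<in> {t + 1..CARD('k)}"
    then have "{y \<in> ?A. ?H y = h} = {y \<in> J_set o1 x. ?H y = h}" by auto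
    then show "(\<Sum>y \<in> {y \<in> ?A. ?H y = h}. f (?H y)) = of_nat (card {y \<in> J_set o1 x. ?H y = h}) * f h"
      by simp
  qed simp
  also have "\<dots> = (\<Sum>h = t + 1..CARD('k). of_nat ((CARD('k) - card (I_set o1 x) choose (h - card (I_set o1 x)))
      * (CARD('s) - 1) ^ (h - card (I_set o1 x))) * f h)"
    using assms by (intro sum.cong) (auto simp: card_J_set_hamming)
  finally show ?thesis .
qed

lemma card_hamming_greater:
  "card {y :: 's::finite ^ 'k::finite. hamming (all_one o1) y > t}
    = (\<Sum>i = t + 1..CARD('k). (CARD('k) choose i) * (CARD('s) - 1) ^ i)"
proof -
  have I: "I_set o1 (all_one o1 :: 's ^ 'k) = {}"
    by (simp add: I_set_def all_one_def)
  then have J: "J_set o1 (all_one o1 :: 's ^ 'k) = UNIV"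
    by (simp add: J_set_def)
  show ?thesis
    using sum_J_set_hamming [of o1 "all_one o1 :: 's ^ 'k" t "\<lambda>_. 1 :: nat"] I J by simp
qed

section \<open>The uniform array and the dimension\<close>

text \<open>By the closed form, the coefficient is \<open>p\<close> plus a signed multiple of
  \<open>alt_sum\<close>, and the sum over \<open>y\<close> contributes the same multiple with the
  opposite sign.\<close>

lemma uniform_array_slack:
  fixes x :: "'s::finite ^ 'k::finite" and l :: nat
  assumes "hamming (all_one o1) x \<le> t" and "t \<le> CARD('k)"
  defines "p \<equiv> real l / real CARD('s) ^ (CARD('k) - t)"
  shows "oa_coeff CARD('k) CARD('s) t l (t - hamming (all_one o1) x)
      + (-1) ^ (t - hamming (all_one o1) x + 1)
        * (\<Sum>y \<in> {y \<in> J_set o1 x. hamming (all_one o1) y > t}.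
             real ((hamming (all_one o1) y - hamming (all_one o1) x - 1)
                     choose (t - hamming (all_one o1) x)) * p) = p"
proof -
  define d where "d = card (I_set o1 x)"
  define j where "j = t - d"
  define r where "r = CARD('k) - t"
  let ?q = "real CARD('s) - 1"
  have d: "d \<le> t" and hd: "hamming (all_one o1) x = d"
    using assms by (simp_all add: d_def hamming_all_one)
  have q: "real (CARD('s) - 1) = ?q"
    by (simp add: of_nat_diff Suc_leI)
  \<comment> \<open>Additive forms of \<open>t\<close> and \<open>k\<close> remove the truncated
    subtractions from the binomials.\<close>
  have t: "t = d + j" and k: "CARD('k) = d + j + r"
    using d assms by (simp_all add: j_def r_def)
  have "(\<Sum>y \<in> {y \<in> J_set o1 x. hamming (all_one o1) y > t}.
             real ((hamming (all_one o1) y - d - 1) choose j) * p)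
      = (\<Sum>h = t + 1..CARD('k). real ((CARD('k) - d choose (h - d)) * (CARD('s) - 1) ^ (h - d))
           * (real ((h - d - 1) choose j) * p))"
    using sum_J_set_hamming [of o1 x t "\<lambda>h. real ((h - d - 1) choose j) * p"] d
    by (simp add: d_def)
  also have "\<dots> = (\<Sum>v<r. real ((CARD('k) - d choose (t + 1 + v - d)) * (CARD('s) - 1) ^ (t + 1 + v - d))
           * (real ((t + 1 + v - d - 1) choose j) * p))"
    by (rule sum.reindex_bij_witness [where i = "\<lambda>v. t + 1 + v" and j = "\<lambda>h. h - (t + 1)"])
      (auto simp: k t)
  also have "\<dots> = p * alt_sum ?q r j"
    unfolding alt_sum_def sum_distrib_left of_nat_mult of_nat_power q
    by (rule sum.cong) (auto simp: k t algebra_simps simp del: binomial_Suc_Suc)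
  finally have S: "(\<Sum>y \<in> {y \<in> J_set o1 x. hamming (all_one o1) y > t}.
             real ((hamming (all_one o1) y - d - 1) choose j) * p) = p * alt_sum ?q r j" .
  have "oa_coeff CARD('k) CARD('s) t l j = p * (1 + (-1) ^ j * alt_sum ?q r j)"
    unfolding p_def r_def by (rule oa_coeff_closed_form) (simp add: Suc_leI)
  then show ?thesis
    unfolding hd j_def [symmetric] S by (simp add: algebra_simps)
qed

theorem theorem4:
  fixes o1 :: "'s::finite" and s k t l m :: nat
  assumes "CARD('s) = s" and "CARD('k::finite) = k"
    and "s \<ge> 2" and "k \<ge> 1" and "t \<le> k" and "l \<ge> 1"
    and "m = (\<Sum>i = t + 1..k. (k choose i) * (s - 1) ^ i)"
  shows "aff_dim (OAP o1 t l :: (real ^ ('s ^ 'k)) set) = int m"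
proof -
  let ?H = "hamming (all_one o1) :: 's ^ 'k \<Rightarrow> nat"
  \<comment> \<open>The coordinate copy of the ambient space, phrased with \<open>y \<notin>\<close>
    to match \<open>dim_substandard_cart\<close>.\<close>
  let ?V = "{N :: real ^ ('s ^ 'k). \<forall>y. y \<notin> {y. ?H y > t} \<longrightarrow> N $ y = 0}"
  define g where "g N x = oa_coeff CARD('k) CARD('s) t l (t - ?H x) + (-1) ^ (t - ?H x + 1)
              * (\<Sum>y \<in> {y \<in> J_set o1 x. ?H y > t}.
                   real ((?H y - ?H x - 1) choose (t - ?H x)) * N $ y)"
    for N :: "real ^ ('s ^ 'k)" and x
  \<comment> \<open>The inequalities made strict: finitely many, each continuous in
    \<open>N\<close>, so \<open>U\<close> is open.\<close>
  define U where "U = (\<Inter>y\<in>{y. ?H y > t}. {N :: real ^ ('s ^ 'k). 0 < N $ y})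
    \<inter> (\<Inter>x\<in>{x. ?H x \<le> t}. {N. 0 < g N x})"
  have "open U"
    unfolding U_def g_def
    by (intro open_Int open_INT finite ballI open_Collect_less continuous_intros)
  then have opn: "openin (top_of_set ?V) (?V \<inter> U)"
    by (rule openin_open_Int)
  have sub: "subspace ?V"
    by (simp add: subspace_def)
  define p where "p = real l / real CARD('s) ^ (CARD('k) - t)"
  have "p > 0"
    using assms by (simp add: p_def)
  define N0 :: "real ^ ('s ^ 'k)" where "N0 = (\<chi> y. if ?H y > t then p else 0)"
  have "g N0 x = p" if "?H x \<le> t" for x
    using uniform_array_slack [of o1 x t l] that assms
    by (simp add: g_def N0_def p_def)
  then have "N0 \<in> ?V \<inter> U"
    using \<open>p > 0\<close> by (auto simp: U_def N0_def)
  \<comment> \<open>A nonempty relatively open subset of an affine set has its full dimension;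
    \<open>N0\<close> witnesses nonemptiness.\<close>
  then have "aff_dim (?V \<inter> U) = aff_dim ?V"
    using aff_dim_openin [OF opn] sub subspace_imp_affine by blast
  moreover have "aff_dim ?V = int (dim ?V)"
    using sub by (rule aff_dim_subspace)
  moreover have "dim ?V = m"
    using assms by (simp only: dim_substandard_cart card_hamming_greater flip: dim_vec_eq)
  ultimately have interior_dim: "aff_dim (?V \<inter> U) = int m" and V_dim: "aff_dim ?V = int m"
    by simp_all
  have "?V \<inter> U \<subseteq> OAP o1 t l"
    by (auto simp: OAP_def U_def g_def intro: less_imp_le)
  then have "int m \<le> aff_dim (OAP o1 t l :: (real ^ ('s ^ 'k)) set)"
    unfolding interior_dim [symmetric] by (rule aff_dim_subset)
  moreover have "OAP o1 t l \<subseteq> ?V"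
    by (auto simp: OAP_def)
  then have "aff_dim (OAP o1 t l :: (real ^ ('s ^ 'k)) set) \<le> int m"
    unfolding V_dim [symmetric] by (rule aff_dim_subset)
  ultimately show ?thesis by simp
qed

end
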